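(* Let $X=\coprod_{\lambda\in\Lambda}G_\lambda$ be a multiple conjugation quandle and let $Y$ be an $X$-set. Then $D_*(X)_Y=(D_n(X)_Y,\partial_n)$ is a subcomplex of $P_*(X)_Y$, i.e. $\partial_n(D_n(X)_Y)\subset D_{n-1}(X)_Y$ for all $n$.
   Context: **MCQ.** A multiple conjugation quandle (MCQ) is a disjoint union $X=\coprod_{\lambda\in\Lambda}G_\lambda$ of groups with a binary operation $*:X\times X\to X$ such that: (1) $a*b=b^{-1}ab$ for $a,b\in G_\lambda$; (2) $x*e_\lambda=x$ and $x*(ab)=(x*a)*b$ for $x\in X$, $a,b\in G_\lambda$, where $e_\lambda$ is the identity of $G_\lambda$; (3) $(x*y)*z=(x*z)*(y*z)$ for $x,y,z\in X$; (4) for $x\in X$, $a,b\in G_\lambda$, the elements $a*x,b*x$ lie in a common group $G_\mu$ and $(ab)*x=(a*x)(b*x)$ in $G_\mu$. **$X$-set.** An $X$-set is a non-empty set $Y$ with a map $*:Y\times X\to Y$ such that $y*e_\lambda=y$ and $y*(ab)=(y*a)*b$ for $y\in Y$, $a,b\in G_\lambda$, and $(y*a)*b=(y*b)*(a*b)$ for $y\in Y$, $a,b\in X$. **Prismatic chains.** For $n\ge 0$, $P_n(X)_Y$ is the free abelian group generated by all tuples $(y;\boldsymbol a_1;\ldots;\boldsymbol a_k)$ with $y\in Y$, $k\ge 0$, where each $\boldsymbol a_i=(a_{i,1},\ldots,a_{i,n_i})$, $n_i\geq 1$, is a finite sequence of elements all lying in one and the same group $G_{\lambda_i}$ ($\lambda_i$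 may vary with $i$), and $n_1+\cdots+n_k=n$. For $n<0$, $P_n(X)_Y=0$. The generator is written $\langle y\rangle\langle\boldsymbol a_1\rangle\cdots\langle\boldsymbol a_k\rangle$, and $|\langle y\rangle\langle\boldsymbol a_1\rangle\cdots\langle\boldsymbol a_k\rangle|:=n_1+\cdots+n_k$. For $b\in X$, $(\langle y\rangle\langle\boldsymbol a_1\rangle\cdots\langle\boldsymbol a_k\rangle)*b:=\langle y*b\rangle\langle\boldsymbol a_1*b\rangle\cdots\langle\boldsymbol a_k*b\rangle$ (entrywise). **Boundary.** $\partial_n:P_n(X)_Y\to P_{n-1}(X)_Y$ is the homomorphism with $$\partial(\langle y\rangle\langle\boldsymbol a_1\rangle\cdots\langle\boldsymbol a_k\rangle)=\sum_{i=1}^k(-1)^{|\langle y\rangle\langle\boldsymbol a_1\rangle\cdots\langle\boldsymbol a_{i-1}\rangle|}\langle y\rangle\langle\boldsymbol a_1\rangle\cdots\partial\langle\boldsymbol a_i\rangle\cdots\langle\boldsymbol a_k\rangle,$$ $$\partial\langle a_1,\ldots,a_m\rangle=*a_1\langle a_2,\ldots,a_m\rangle+\sum_{i=1}^{m-1}(-1)^i\langle a_1,\ldots,a_ia_{i+1},\ldots,a_m\rangle+(-1)^m\langle a_1,\ldots,a_{m-1}\rangle,$$ where $*a_1$ is applied to the whole expression standing to its left, and an empty factor $\langle\ \rangle$ (for $m=1$) is deleted. $\partial\langle y\rangle=0$. **Decomposition degeneracies.** For $\boldsymbol a=(a_1,\ldots,a_s)$, $\boldsymbol b=(b_1,\ldots,b_t)$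 with all entries in one $G_\lambda$ and $1\le i_1<\cdots<i_s\le s+t$, put $\langle\langle\boldsymbol a\rangle\langle\boldsymbol b\rangle\rangle_{i_1,\ldots,i_s}:=(-1)^{\sum_{k=1}^s(i_k-k)}\langle c_1,\ldots,c_{s+t}\rangle$, where $c_i=a_k*(b_1\cdots b_{i-k})$ if $i=i_k$ (just $a_k$ if $i=k$), and $c_i=b_{i-k}$ if $i_k<i<i_{k+1}$ (with $i_0=0$, $i_{s+1}=s+t+1$). Put $\langle\langle\boldsymbol a\rangle\langle\boldsymbol b\rangle\rangle:=\sum_{1\le i_1<\cdots<i_s\le s+t}\langle\langle\boldsymbol a\rangle\langle\boldsymbol b\rangle\rangle_{i_1,\ldots,i_s}$. $D_n(X)_Y\subset P_n(X)_Y$ is the subgroup generated by all elements $$\langle y\rangle\langle\boldsymbol a_1\rangle\cdots\langle\boldsymbol a\rangle\langle\boldsymbol b\rangle\cdots\langle\boldsymbol a_k\rangle-\langle y\rangle\langle\boldsymbol a_1\rangle\cdots\langle\langle\boldsymbol a\rangle\langle\boldsymbol b\rangle\rangle\cdots\langle\boldsymbol a_k\rangle$$ (extended linearly), where $\boldsymbol a,\boldsymbol b$ are adjacent factors with all entries in one common $G_\lambda$. *)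

theory Defs
  imports "HOL-Algebra.Free_Abelian_Groups" "HOL-Library.Disjoint_Sets"
begin

locale multiple_conjugation_quandle =
  fixes \<Lambda> :: "'l set"
    and G :: "'l \<Rightarrow> ('a, 'm) monoid_scheme"
    and star :: "'a \<Rightarrow> 'a \<Rightarrow> 'a" (infixl "\<star>" 75)
  assumes group_G: "l \<in> \<Lambda> \<Longrightarrow> group (G l)"
    and disjoint_G: "disjoint_family_on (\<lambda>l. carrier (G l)) \<Lambda>"
    and star_closed:
      "\<lbrakk>x \<in> (\<Union>l\<in>\<Lambda>. carrier (G l)); y \<in> (\<Union>l\<in>\<Lambda>. carrier (G l))\<rbrakk>
        \<Longrightarrow> x \<star> y \<in> (\<Union>l\<in>\<Lambda>. carrier (G l))"
    and star_conj:
      "\<lbrakk>l \<in> \<Lambda>; a \<in> carrier (G l); b \<in> carrier (G l)\<rbrakk>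
        \<Longrightarrow> a \<star> b = inv\<^bsub>G l\<^esub> b \<otimes>\<^bsub>G l\<^esub> a \<otimes>\<^bsub>G l\<^esub> b"
    and star_one:
      "\<lbrakk>x \<in> (\<Union>l\<in>\<Lambda>. carrier (G l)); l \<in> \<Lambda>\<rbrakk> \<Longrightarrow> x \<star> \<one>\<^bsub>G l\<^esub> = x"
    and star_mult:
      "\<lbrakk>x \<in> (\<Union>l\<in>\<Lambda>. carrier (G l)); l \<in> \<Lambda>; a \<in> carrier (G l); b \<in> carrier (G l)\<rbrakk>
        \<Longrightarrow> x \<star> (a \<otimes>\<^bsub>G l\<^esub> b) = (x \<star> a) \<star> b"
    and star_distrib:
      "\<lbrakk>x \<in> (\<Union>l\<in>\<Lambda>. carrier (G l)); y \<in> (\<Union>l\<in>\<Lambda>. carrier (G l));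
        z \<in> (\<Union>l\<in>\<Lambda>. carrier (G l))\<rbrakk>
        \<Longrightarrow> (x \<star> y) \<star> z = (x \<star> z) \<star> (y \<star> z)"
    and star_hom:
      "\<lbrakk>x \<in> (\<Union>l\<in>\<Lambda>. carrier (G l)); l \<in> \<Lambda>; a \<in> carrier (G l); b \<in> carrier (G l)\<rbrakk>
        \<Longrightarrow> \<exists>\<mu>\<in>\<Lambda>. a \<star> x \<in> carrier (G \<mu>) \<and> b \<star> x \<in> carrier (G \<mu>) \<and>
              (a \<otimes>\<^bsub>G l\<^esub> b) \<star> x = (a \<star> x) \<otimes>\<^bsub>G \<mu>\<^esub> (b \<star> x)"
begin

definition X :: "'a set" where
  "X = (\<Union>l\<in>\<Lambda>. carrier (G l))"

definition in_one_group :: "'a set \<Rightarrow> bool" where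
  "in_one_group A \<longleftrightarrow> (\<exists>l\<in>\<Lambda>. A \<subseteq> carrier (G l))"

(* The index is determined by a because the carriers are disjoint. *)
definition gmult :: "'a \<Rightarrow> 'a \<Rightarrow> 'a" where
  "gmult a b = a \<otimes>\<^bsub>G (THE l. l \<in> \<Lambda> \<and> a \<in> carrier (G l))\<^esub> b"

(* Only meaningful for nonempty lists; there is no canonical identity to return for []. *)
definition gprod :: "'a list \<Rightarrow> 'a" where
  "gprod bs = foldl gmult (hd bs) (tl bs)"

(* The tuple c_1, ..., c_{s+t} for the index set I = {i_1 < ... < i_s}: the number k of
   elements of I that are at most i satisfies i = i_k if i is in I, and i_k < i < i_{k+1}
   otherwise. Entries are numbered from 1, list positions from 0. *)
definition shuffle_tuple :: "nat set \<Rightarrow> 'a list \<Rightarrow> 'a list \<Rightarrow> 'a list" where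
  "shuffle_tuple I as bs =
     map (\<lambda>i. let k = card {j \<in> I. j \<le> i} in
            if i \<in> I
            then (if i = k then as ! (k - 1) else as ! (k - 1) \<star> gprod (take (i - k) bs))
            else bs ! (i - k - 1))
       [1..<length as + length bs + 1]"

definition shuffle_sign :: "nat set \<Rightarrow> int" where
  "shuffle_sign I = (-1) ^ (\<Sum>i\<in>I. i - card {j \<in> I. j \<le> i})"

definition shuffle :: "'a list \<Rightarrow> 'a list \<Rightarrow> 'a list \<Rightarrow>\<^sub>0 int" where
  "shuffle as bs =
     (\<Sum>I | I \<subseteq> {1..length as + length bs} \<and> card I = length as.
        frag_cmul (shuffle_sign I) (frag_of (shuffle_tuple I as bs)))"

end

locale mcq_set = multiple_conjugation_quandle \<Lambda> G star
  for \<Lambda> :: "'l set"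
    and G :: "'l \<Rightarrow> ('a, 'm) monoid_scheme"
    and star :: "'a \<Rightarrow> 'a \<Rightarrow> 'a" (infixl "\<star>" 75) +
  fixes Y :: "'y set"
    and act :: "'y \<Rightarrow> 'a \<Rightarrow> 'y" (infixl "\<star>\<^sub>Y" 75)
  assumes Y_nonempty: "Y \<noteq> {}"
    and act_closed: "\<lbrakk>y \<in> Y; a \<in> X\<rbrakk> \<Longrightarrow> y \<star>\<^sub>Y a \<in> Y"
    and act_one: "\<lbrakk>y \<in> Y; l \<in> \<Lambda>\<rbrakk> \<Longrightarrow> y \<star>\<^sub>Y \<one>\<^bsub>G l\<^esub> = y"
    and act_mult:
      "\<lbrakk>y \<in> Y; l \<in> \<Lambda>; a \<in> carrier (G l); b \<in> carrier (G l)\<rbrakk>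
        \<Longrightarrow> y \<star>\<^sub>Y (a \<otimes>\<^bsub>G l\<^esub> b) = (y \<star>\<^sub>Y a) \<star>\<^sub>Y b"
    and act_distrib:
      "\<lbrakk>y \<in> Y; a \<in> X; b \<in> X\<rbrakk> \<Longrightarrow> (y \<star>\<^sub>Y a) \<star>\<^sub>Y b = (y \<star>\<^sub>Y b) \<star>\<^sub>Y (a \<star> b)"
begin

(* (y, [a_1, ..., a_k]) stands for the generator <y><a_1>...<a_k>. *)
definition prism_gens :: "int \<Rightarrow> ('y \<times> 'a list list) set" where
  "prism_gens n =
     {(y, fs). y \<in> Y \<and> (\<forall>as \<in> set fs. as \<noteq> [] \<and> in_one_group (set as))
        \<and> int (sum_list (map length fs)) = n}"

definition prism_chains :: "int \<Rightarrow> ('y \<times> 'a list list \<Rightarrow>\<^sub>0 int) monoid" where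
  "prism_chains n = free_Abelian_group (prism_gens n)"

definition factor :: "'a list \<Rightarrow> 'a list list" where
  "factor as = (if as = [] then [] else [as])"

(* <y> pre (boundary of <as>) post, where the operator *a_1 in the first term acts on
   <y> pre. *)
definition factor_boundary ::
  "'y \<Rightarrow> 'a list list \<Rightarrow> 'a list \<Rightarrow> 'a list list \<Rightarrow> ('y \<times> 'a list list) \<Rightarrow>\<^sub>0 int" where
  "factor_boundary y pre as post =
     frag_of (y \<star>\<^sub>Y hd as, map (map (\<lambda>x. x \<star> hd as)) pre @ factor (tl as) @ post)
     + (\<Sum>i = 1..<length as.
          frag_cmul ((-1) ^ i)
            (frag_of (y, pre @ [take (i - 1) as @ [gmult (as ! (i - 1)) (as ! i)] @ drop (i + 1) as]
                         @ post)))
     + frag_cmul ((-1) ^ length as) (frag_of (y, pre @ factor (butlast as) @ post))"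

definition gen_boundary :: "'y \<times> 'a list list \<Rightarrow> ('y \<times> 'a list list) \<Rightarrow>\<^sub>0 int" where
  "gen_boundary = (\<lambda>(y, fs).
     \<Sum>i<length fs.
       frag_cmul ((-1) ^ sum_list (map length (take i fs)))
         (factor_boundary y (take i fs) (fs ! i) (drop (Suc i) fs)))"

(* A single map; the n-th boundary homomorphism is its restriction to degree n chains. *)
definition boundary :: "(('y \<times> 'a list list) \<Rightarrow>\<^sub>0 int) \<Rightarrow> ('y \<times> 'a list list) \<Rightarrow>\<^sub>0 int" where
  "boundary = frag_extend gen_boundary"

definition degen_gens :: "int \<Rightarrow> (('y \<times> 'a list list) \<Rightarrow>\<^sub>0 int) set" where
  "degen_gens n =
     {frag_of (y, pre @ [as, bs] @ post)
        - frag_extend (\<lambda>cs. frag_of (y, pre @ [cs] @ post)) (shuffle as bs)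
      | y pre as bs post.
        (y, pre @ [as, bs] @ post) \<in> prism_gens n \<and> in_one_group (set as \<union> set bs)}"

definition degen_chains :: "int \<Rightarrow> (('y \<times> 'a list list) \<Rightarrow>\<^sub>0 int) set" where
  "degen_chains n = generate (prism_chains n) (degen_gens n)"

end

end

theory Submission
  imports Defs
begin

text \<open>The shuffle sum satisfies a recursion on the first entry of each term, which is either the first
  entry of \<open>a\<close>, or the first entry \<open>b\<^sub>1\<close> of \<open>b\<close> followed by a shuffle of \<open>a * b\<^sub>1\<close> with the rest
  of \<open>b\<close>. Since \<open>b (a * b) = a b\<close> in a group, the merged neighbours that come from different factors
  cancel in pairs, and a Leibniz rule for \<open>\<langle>\<langle>a\<rangle>\<langle>b\<rangle>\<rangle>\<close> follows by induction. Hence the boundary of a degeneracy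
  generator is a combination of degeneracy generators: the boundary acts either on \<open>\<langle>a\<rangle>\<langle>b\<rangle>\<close> or on
  another factor, and in the latter case the action of \<open>X\<close> commutes with shuffling by
  self-distributivity. If a boundary term empties \<open>a\<close> or \<open>b\<close>, the corresponding difference is zero.\<close>

subsection \<open>Linear extension and sums\<close>

lemma frag_extend_compose:
  "frag_extend f (frag_extend g c) = frag_extend (\<lambda>x. frag_extend f (g x)) c"
  using subset_UNIV[of "Poly_Mapping.keys c"]
  by (induction c rule: frag_induction) (simp_all add: frag_extend_diff)

lemma frag_extend_fun_add:
  "frag_extend (\<lambda>x. f x + g x) c = frag_extend f c + frag_extend g c"
  using subset_UNIV[of "Poly_Mapping.keys c"]
  by (induction c rule: frag_induction) (simp_all add: frag_extend_diff)

lemma frag_extend_fun_diff: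
  "frag_extend (\<lambda>x. f x - g x) c = frag_extend f c - frag_extend g c"
  using subset_UNIV[of "Poly_Mapping.keys c"]
  by (induction c rule: frag_induction) (simp_all add: frag_extend_diff)

lemma frag_extend_fun_minus:
  "frag_extend (\<lambda>x. - f x) c = - frag_extend f c"
  using subset_UNIV[of "Poly_Mapping.keys c"]
  by (induction c rule: frag_induction) (simp_all add: frag_extend_diff)

lemma frag_cmul_diff_distrib2: "frag_cmul k (a - b) = frag_cmul k a - frag_cmul k b"
  using frag_cmul_distrib2[of k a "- b"]
  by (metis add_uminus_conv_diff frag_cmul_cmul frag_cmul_minus_one mult.commute)

lemma frag_extend_fun_cmul:
  "frag_extend (\<lambda>x. frag_cmul k (f x)) c = frag_cmul k (frag_extend f c)"
  using subset_UNIV[of "Poly_Mapping.keys c"]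
  by (induction c rule: frag_induction) (simp_all add: frag_extend_diff frag_cmul_diff_distrib2)

lemma frag_cmul_uminus2: "frag_cmul k (- a) = - frag_cmul k a"
  using frag_cmul_diff_distrib2[of k 0 a] by simp

lemmas frag_linear = frag_extend_compose frag_extend_fun_add frag_extend_fun_diff
  frag_extend_fun_minus frag_extend_fun_cmul frag_extend_add frag_extend_diff frag_extend_minus
  frag_extend_cmul frag_cmul_distrib2 frag_cmul_diff_distrib2 frag_cmul_uminus2

abbreviation push :: "('b \<Rightarrow> 'c) \<Rightarrow> ('b \<Rightarrow>\<^sub>0 int) \<Rightarrow> ('c \<Rightarrow>\<^sub>0 int)" where
  "push f \<equiv> frag_extend (\<lambda>x. frag_of (f x))"

lemma keys_push: "Poly_Mapping.keys (push f c) \<subseteq> f ` Poly_Mapping.keys c"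
  using keys_frag_extend[of "\<lambda>x. frag_of (f x)" c] by (auto simp: keys_frag_of)

lemma push_id: "push (\<lambda>x. x) c = c"
  by (metis frag_expansion)

text \<open>Both sides are the same double sum over the supports of \<open>c\<close> and
  \<open>d\<close>. This exchanges the boundary of one factor with the shuffling of two other
  factors.\<close>

lemma frag_extend_swap:
  "frag_extend (\<lambda>x. frag_extend (h x) d) c = frag_extend (\<lambda>z. frag_extend (\<lambda>x. h x z) c) d"
  using subset_UNIV[of "Poly_Mapping.keys c"]
  by (induction c rule: frag_induction)
    (simp_all add: frag_extend_diff frag_extend_fun_diff frag_extend_eq_0)

lemma frag_extend_fun_sum:
  "frag_extend (\<lambda>x. \<Sum>i\<in>I. f i x) c = (\<Sum>i\<in>I. frag_extend (f i) c)"
  by (induction I rule: infinite_finite_induct) (simp_all add: frag_extend_fun_add frag_extend_eq_0)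

lemma sum_lessThan_add:
  fixes f :: "nat \<Rightarrow> 'b::comm_monoid_add"
  shows "sum f {..<m + k} = sum f {..<m} + (\<Sum>i<k. f (m + i))"
  by (induction k) (simp_all add: add.assoc)

text \<open>\<open>h\<close> sees a position of a list as prefix, entry and suffix, the form in
  which \<open>gen_boundary\<close> sums over factors. The split isolates the factors on either side
  of a shuffled pair.\<close>

lemma sum_splits_append:
  fixes h :: "'a list \<Rightarrow> 'a \<Rightarrow> 'a list \<Rightarrow> 'b::comm_monoid_add"
  shows "(\<Sum>i<length (us @ vs). h (take i (us @ vs)) ((us @ vs) ! i) (drop (Suc i) (us @ vs)))
    = (\<Sum>i<length us. h (take i us) (us ! i) (drop (Suc i) us @ vs))
      + (\<Sum>i<length vs. h (us @ take i vs) (vs ! i) (drop (Suc i) vs))"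
  unfolding length_append sum_lessThan_add
  by (intro arg_cong2[of _ _ _ _ "(+)"] sum.cong) (auto simp: nth_append)

subsection \<open>Index sets of shuffles\<close>

text \<open>Pascal's rule for index sets: \<open>I\<close> contains 1 or not, and the rest is
  shifted down by one. The two cases become the two terms of the shuffle recursion.\<close>

lemma sum_subsets_Suc:
  "(\<Sum>I | I \<subseteq> {1..Suc n} \<and> card I = Suc s. f I)
    = (\<Sum>J | J \<subseteq> {1..n} \<and> card J = s. f (insert 1 (Suc ` J)))
      + (\<Sum>J | J \<subseteq> {1..n} \<and> card J = Suc s. f (Suc ` J))"
proof -
  let ?S = "\<lambda>n s. {I. I \<subseteq> {1..n::nat} \<and> card I = s}"
  have fin: "finite (?S n s)" for n s by simp
  have card_Suc: "card (Suc ` J) = card J" for J by (simp add: card_image)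
  have card_ins: "card (insert 1 (Suc ` J)) = Suc (card J)" if "J \<subseteq> {1..n}" for J
    using that finite_subset[OF that] card_Suc[of J] by (subst card_insert_disjoint) auto
  have preimage: "Suc ` {j. 0 < j \<and> Suc j \<in> I} = I - {1}" if "I \<subseteq> {1..Suc n}" for I :: "nat set"
  proof (intro equalityI subsetI)
    fix i assume "i \<in> I - {1}"
    with that show "i \<in> Suc ` {j. 0 < j \<and> Suc j \<in> I}"
      by (cases i) (auto simp: subset_iff intro!: gr0I)
  qed auto
  have split: "?S (Suc n) (Suc s)
    = (\<lambda>J. insert 1 (Suc ` J)) ` ?S n s \<union> image Suc ` ?S n (Suc s)" (is "_ = ?L \<union> ?R")
  proof (intro equalityI subsetI)
    fix I assume I: "I \<in> ?S (Suc n) (Suc s)"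
    \<comment> \<open>The condition \<open>0 < j\<close> removes the preimage of 1, so
      \<open>?J\<close> encodes \<open>I\<close> without its possible first position.\<close>
    let ?J = "{j. 0 < j \<and> Suc j \<in> I}"
    have J: "?J \<subseteq> {1..n}" using I by auto
    show "I \<in> ?L \<union> ?R"
    proof (cases "1 \<in> I")
      case True
      then have "I = insert 1 (Suc ` ?J)" using preimage I by auto
      with card_ins[OF J] I J have "I \<in> ?L" by (intro image_eqI[of _ _ ?J]) auto
      then show ?thesis ..
    next
      case False
      then have "I = Suc ` ?J" using preimage I by auto
      with card_Suc[of ?J] I J have "I \<in> ?R" by (intro image_eqI[of _ _ ?J]) auto
      then show ?thesis ..
    qed
  next
    fix I assume "I \<in> ?L \<union> ?R"
    then show "I \<in> ?S (Suc n) (Suc s)" using card_ins card_Suc by auto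
  qed
  have "inj_on (\<lambda>J. insert 1 (Suc ` J)) (?S n s)"
  proof (rule inj_onI)
    fix J K assume "J \<in> ?S n s" "K \<in> ?S n s" "insert 1 (Suc ` J) = insert 1 (Suc ` K)"
    moreover from this have "1 \<notin> Suc ` J" "1 \<notin> Suc ` K" by auto
    ultimately show "J = K" by (metis inj_Suc inj_image_eq_iff insert_ident)
  qed
  moreover have "inj_on (image Suc) (?S n (Suc s))"
    by (meson inj_Suc inj_image_eq_iff inj_onI)
  moreover have "?L \<inter> ?R = {}"
  proof -
    have "insert 1 (Suc ` J) \<noteq> Suc ` K" if "K \<subseteq> {1..n}" for J K
      using that by (metis One_nat_def atLeastAtMost_iff image_iff insertI1 nat.inject not_one_le_zero subsetD)
    then show ?thesis by auto
  qed
  ultimately show ?thesis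
    unfolding split by (subst sum.union_disjoint) (simp_all add: fin sum.reindex)
qed

text \<open>The count \<open>card {j \<in> I. j \<le> i}\<close> is the rank \<open>k\<close> in
  \<open>shuffle_tuple\<close> and \<open>shuffle_sign\<close>. Adding position 1 raises it by one
  under the shift; the shift alone, in \<open>card_Suc_atMost\<close>, leaves it unchanged.\<close>

lemma card_insert_Suc_atMost:
  assumes "finite J" "0 \<notin> J"
  shows "card {j \<in> insert 1 (Suc ` J). j \<le> Suc i} = Suc (card {j \<in> J. j \<le> i})"
proof -
  have "{j \<in> insert 1 (Suc ` J). j \<le> Suc i} = insert 1 (Suc ` {j \<in> J. j \<le> i})" by auto
  moreover have "1 \<notin> Suc ` {j \<in> J. j \<le> i}" using assms by auto
  ultimately show ?thesis using assms by (simp add: card_image)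
qed

lemma card_Suc_atMost: "card {j \<in> Suc ` J. j \<le> Suc i} = card {j \<in> J. j \<le> i}"
proof -
  have "{j \<in> Suc ` J. j \<le> Suc i} = Suc ` {j \<in> J. j \<le> i}" by auto
  then show ?thesis by (simp add: card_image)
qed

text \<open>Positions start at 1, so at most \<open>i\<close> of them are \<open>\<le> i\<close>.
  Hence the difference of position and rank never truncates on natural numbers.\<close>

lemma card_atMost_le:
  assumes "0 \<notin> J" shows "card {j \<in> J. j \<le> i} \<le> i"
proof -
  have "{j \<in> J. j \<le> i} \<subseteq> {1..i}" using assms by (auto simp: Suc_le_eq intro!: gr0I)
  then show ?thesis using card_mono[of "{1..i}"] by fastforce
qed

text \<open>For \<open>i\<close> outside \<open>J\<close> only \<open>i - 1\<close> candidates
  remain, so the index \<open>i - k - 1\<close> into \<open>bs\<close> is a true difference.\<close>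

lemma card_atMost_less:
  assumes "0 \<notin> J" "i \<notin> J" "0 < i" shows "card {j \<in> J. j \<le> i} < i"
proof -
  have "j \<le> i \<longleftrightarrow> j \<le> i - 1" if "j \<in> J" for j
    using that assms by (cases "j = i") auto
  then have "{j \<in> J. j \<le> i} = {j \<in> J. j \<le> i - 1}" by blast
  then show ?thesis using card_atMost_le[OF assms(1), of "i - 1"] assms(3) by simp
qed

lemma card_atMost_pos:
  assumes "finite J" "i \<in> J" shows "0 < card {j \<in> J. j \<le> (i::nat)}"
proof -
  have "card {i} \<le> card {j \<in> J. j \<le> i}"
    using assms by (intro card_mono) auto
  then show ?thesis by simp
qed

context multiple_conjugation_quandle
begin

subsection \<open>The quandle operation on groups\<close>

lemma gmult_eq:
  assumes "l \<in> \<Lambda>" "a \<in> carrier (G l)"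
  shows "gmult a b = a \<otimes>\<^bsub>G l\<^esub> b"
proof -
  have "(THE l. l \<in> \<Lambda> \<and> a \<in> carrier (G l)) = l"
    using assms disjoint_G by (intro the_equality) (auto simp: disjoint_family_on_def)
  then show ?thesis by (simp add: gmult_def)
qed

lemma gmult_closed:
  assumes "l \<in> \<Lambda>" "a \<in> carrier (G l)" "b \<in> carrier (G l)"
  shows "gmult a b \<in> carrier (G l)"
proof -
  interpret group "G l" using assms group_G by simp
  show ?thesis using assms by (simp add: gmult_eq)
qed

lemma carrier_subset_X: "l \<in> \<Lambda> \<Longrightarrow> carrier (G l) \<subseteq> X"
  by (auto simp: X_def)

lemma star_in_group:
  assumes "l \<in> \<Lambda>" "a \<in> carrier (G l)" "b \<in> carrier (G l)"
  shows "a \<star> b \<in> carrier (G l)"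
proof -
  interpret group "G l" using assms group_G by simp
  show ?thesis using assms by (simp add: star_conj)
qed

lemma star_X: "x \<in> X \<Longrightarrow> y \<in> X \<Longrightarrow> x \<star> y \<in> X"
  using star_closed by (simp add: X_def)

text \<open>Conjugation cancels. Merging \<open>b\<close> with \<open>a \<star> b\<close> gives the
  same entry as merging \<open>a\<close> with \<open>b\<close>, the source of the cancellation in
  \<open>inner_bd_shuf\<close>.\<close>

lemma gmult_star_commute:
  assumes "l \<in> \<Lambda>" "a \<in> carrier (G l)" "b \<in> carrier (G l)"
  shows "gmult b (a \<star> b) = gmult a b"
proof -
  interpret group "G l" using assms group_G by simp
  show ?thesis using assms by (simp add: star_conj gmult_eq m_assoc[symmetric])
qed

lemma gmult_assoc:
  assumes "l \<in> \<Lambda>" "a \<in> carrier (G l)" "b \<in> carrier (G l)" "c \<in> carrier (G l)"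
  shows "gmult (gmult a b) c = gmult a (gmult b c)"
proof -
  interpret group "G l" using assms group_G by simp
  show ?thesis using assms by (simp add: gmult_eq m_assoc)
qed

lemma star_gmult:
  assumes "x \<in> X" "l \<in> \<Lambda>" "a \<in> carrier (G l)" "b \<in> carrier (G l)"
  shows "x \<star> gmult a b = x \<star> a \<star> b"
  using assms star_mult by (simp add: X_def gmult_eq)

lemma gmult_star_hom:
  assumes "x \<in> X" "l \<in> \<Lambda>" "a \<in> carrier (G l)" "b \<in> carrier (G l)"
  shows "gmult a b \<star> x = gmult (a \<star> x) (b \<star> x)"
  using star_hom[of x l a b] assms by (auto simp: X_def gmult_eq)

text \<open>The axiom \<open>star_hom\<close> chooses \<open>\<mu>\<close> separately for each pair.
  Pairing every \<open>a\<close> with the identity, and using that the carriers are disjoint, forces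
  one \<open>\<mu>\<close> for the whole group.\<close>

lemma star_in_same_group:
  assumes "x \<in> X" "l \<in> \<Lambda>"
  shows "\<exists>\<mu>\<in>\<Lambda>. \<forall>a\<in>carrier (G l). a \<star> x \<in> carrier (G \<mu>)"
proof -
  interpret group "G l" using assms group_G by simp
  obtain \<mu> where \<mu>: "\<mu> \<in> \<Lambda>" "\<one>\<^bsub>G l\<^esub> \<star> x \<in> carrier (G \<mu>)"
    using star_hom[of x l "\<one>\<^bsub>G l\<^esub>" "\<one>\<^bsub>G l\<^esub>"] assms by (auto simp: X_def)
  have "a \<star> x \<in> carrier (G \<mu>)" if a: "a \<in> carrier (G l)" for a
  proof -
    obtain \<nu> where \<nu>: "\<nu> \<in> \<Lambda>" "\<one>\<^bsub>G l\<^esub> \<star> x \<in> carrier (G \<nu>)" "a \<star> x \<in> carrier (G \<nu>)"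
      using star_hom[of x l "\<one>\<^bsub>G l\<^esub>" a] assms a by (auto simp: X_def)
    then have "\<nu> = \<mu>" using disjoint_G \<mu> by (auto simp: disjoint_family_on_def)
    with \<nu> show ?thesis by simp
  qed
  with \<mu> show ?thesis by blast
qed

lemma in_one_group_star:
  assumes "x \<in> X" "in_one_group A"
  shows "in_one_group ((\<lambda>a. a \<star> x) ` A)"
proof -
  obtain l where "l \<in> \<Lambda>" "A \<subseteq> carrier (G l)"
    using assms by (auto simp: in_one_group_def)
  then show ?thesis
    using star_in_same_group[OF assms(1), of l] by (force simp: in_one_group_def)
qed

lemma in_one_group_subset: "in_one_group B \<Longrightarrow> A \<subseteq> B \<Longrightarrow> in_one_group A"
  unfolding in_one_group_def by blast

lemma in_one_group_X: "in_one_group A \<Longrightarrow> A \<subseteq> X"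
  unfolding in_one_group_def X_def by blast

subsection \<open>Shuffles by recursion\<close>

text \<open>The cases ask whether position 1 belongs to the first list. Moving \<open>b\<close> to
  the front crosses all \<open>Suc (length as)\<close> entries, hence the sign, and makes
  \<open>b\<close> act on them at once; repeated steps build up the products b_1 ...
  b_(i-k).\<close>

fun shuf :: "'a list \<Rightarrow> 'a list \<Rightarrow> 'a list \<Rightarrow>\<^sub>0 int" where
  "shuf [] bs = frag_of bs"
| "shuf (a # as) [] = frag_of (a # as)"
| "shuf (a # as) (b # bs) =
     push (Cons a) (shuf as (b # bs))
     + frag_cmul ((-1) ^ Suc (length as)) (push (Cons b) (shuf (map (\<lambda>x. x \<star> b) (a # as)) bs))"

lemma shuf_Nil2 [simp]: "shuf as [] = frag_of as"
  by (cases as) auto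

lemma shuf_Nil1: "shuf [] = frag_of"
  by (rule ext) simp

lemma keys_shuf:
  assumes "l \<in> \<Lambda>" "set as \<subseteq> carrier (G l)" "set bs \<subseteq> carrier (G l)"
    and "c \<in> Poly_Mapping.keys (shuf as bs)"
  shows "length c = length as + length bs \<and> set c \<subseteq> carrier (G l)"
  using assms
proof (induction as bs arbitrary: c rule: shuf.induct)
  case (3 a as b bs)
  have "Poly_Mapping.keys (shuf (a # as) (b # bs)) \<subseteq> Cons a ` Poly_Mapping.keys (shuf as (b # bs))
      \<union> Cons b ` Poly_Mapping.keys (shuf (map (\<lambda>x. x \<star> b) (a # as)) bs)"
    unfolding shuf.simps
    by (rule order.trans[OF keys_add Un_mono[OF keys_push order.trans[OF keys_cmul keys_push]]])
  with 3(6) consider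
      (1) d where "d \<in> Poly_Mapping.keys (shuf as (b # bs))" "c = a # d"
    | (2) d where "d \<in> Poly_Mapping.keys (shuf (map (\<lambda>x. x \<star> b) (a # as)) bs)" "c = b # d"
    by blast
  then show ?case
  proof cases
    case 1
    have "set as \<subseteq> carrier (G l)" using 3(4) by simp
    from 3(1)[OF 3(3) this 3(5) 1(1)] 3(4) 1(2) show ?thesis by simp
  next
    case 2
    have "set (map (\<lambda>x. x \<star> b) (a # as)) \<subseteq> carrier (G l)"
      using 3 by (auto intro: star_in_group)
    moreover have "set bs \<subseteq> carrier (G l)" using 3(5) by simp
    ultimately show ?thesis using 3(2)[OF 3(3) _ _ 2(1)] 3(5) 2(2) by simp
  qed
qed (auto simp: keys_frag_of)

text \<open>By self-distributivity, acting with \<open>b\<close> and then \<open>x\<close> equals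
  acting with \<open>x\<close> and then \<open>b \<star> x\<close>, so the action passes through
  each step of the recursion.\<close>

lemma shuf_map_star:
  assumes "x \<in> X" "set as \<subseteq> X" "set bs \<subseteq> X"
  shows "shuf (map (\<lambda>a. a \<star> x) as) (map (\<lambda>a. a \<star> x) bs)
    = push (map (\<lambda>a. a \<star> x)) (shuf as bs)"
  using assms(2,3)
proof (induction as bs rule: shuf.induct)
  case (3 a as b bs)
  have X: "set (map (\<lambda>x. x \<star> b) (a # as)) \<subseteq> X"
    using 3 by (auto intro: star_X)
  have *: "u \<star> x \<star> (b \<star> x) = u \<star> b \<star> x" if "u \<in> X" for u
    using star_distrib[of u b x] assms that 3 by (simp add: X_def)
  then have "map (\<lambda>u. u \<star> (b \<star> x)) (map (\<lambda>a. a \<star> x) (a # as))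
    = map (\<lambda>a. a \<star> x) (map (\<lambda>x. x \<star> b) (a # as))"
    using 3 by auto
  then have "shuf (map (\<lambda>a. a \<star> x) (a # as)) (map (\<lambda>a. a \<star> x) (b # bs)) =
      push (Cons (a \<star> x)) (shuf (map (\<lambda>a. a \<star> x) as) (map (\<lambda>a. a \<star> x) (b # bs)))
      + frag_cmul ((-1) ^ Suc (length as)) (push (Cons (b \<star> x))
          (shuf (map (\<lambda>a. a \<star> x) (map (\<lambda>x. x \<star> b) (a # as))) (map (\<lambda>a. a \<star> x) bs)))"
    by (simp only: list.map shuf.simps length_map)
  also have "\<dots> = push (map (\<lambda>a. a \<star> x)) (shuf (a # as) (b # bs))"
    using 3(1)[OF _ 3(4)] 3(2)[OF X] 3(3,4) by (simp add: frag_linear)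
  finally show ?case .
qed auto

subsection \<open>The boundary of a single factor\<close>

text \<open>The empty case supplies the last boundary term: an entry with no right neighbour is
  dropped. The recursion for \<open>inner_bd\<close> then needs no separate final term.\<close>

fun merge_head :: "'a \<Rightarrow> 'a list \<Rightarrow> 'a list" where
  "merge_head x [] = []"
| "merge_head x (y # zs) = gmult x y # zs"

text \<open>All terms of the boundary of a factor except the first one, which also acts on the factors to
  the left.\<close>

fun inner_bd :: "'a list \<Rightarrow> 'a list \<Rightarrow>\<^sub>0 int" where
  "inner_bd [] = 0"
| "inner_bd (x # c) = - frag_of (merge_head x c) - push (Cons x) (inner_bd c)"

lemma keys_inner_bd:
  assumes "l \<in> \<Lambda>" "set as \<subseteq> carrier (G l)" "c \<in> Poly_Mapping.keys (inner_bd as)"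
  shows "Suc (length c) = length as \<and> set c \<subseteq> carrier (G l)"
  using assms
proof (induction as arbitrary: c)
  case (Cons a as)
  from Cons(4) consider "c = merge_head a as"
    | d where "d \<in> Poly_Mapping.keys (inner_bd as)" "c = a # d"
    using keys_diff[of "- frag_of (merge_head a as)" "push (Cons a) (inner_bd as)"]
      keys_push[of "Cons a" "inner_bd as"] by (auto simp: keys_frag_of)
  then show ?case
  proof cases
    case 1
    with Cons show ?thesis by (cases as) (auto intro: gmult_closed)
  next
    case 2
    with Cons show ?thesis by auto
  qed
qed simp

lemma inner_bd_map_star:
  assumes "l \<in> \<Lambda>" "set as \<subseteq> carrier (G l)" "x \<in> X"
  shows "inner_bd (map (\<lambda>a. a \<star> x) as) = push (map (\<lambda>a. a \<star> x)) (inner_bd as)"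
  using assms(2)
proof (induction as)
  case (Cons a as)
  have "merge_head (a \<star> x) (map (\<lambda>a. a \<star> x) as) = map (\<lambda>a. a \<star> x) (merge_head a as)"
    using Cons assms by (cases as) (auto simp: gmult_star_hom)
  with Cons show ?case by (simp add: frag_linear)
qed simp

lemma inner_bd_push_Cons:
  "frag_extend inner_bd (push (Cons x) c)
    = - push (merge_head x) c - push (Cons x) (frag_extend inner_bd c)"
  by (simp add: frag_linear)

text \<open>Both sides are expanded by the first entry. Tuples starting with
  \<open>gmult a b\<close> arise once from \<open>a\<close> before \<open>b\<close> and once from
  \<open>b\<close> before \<open>a \<star> b\<close>, with opposite signs; the others match after
  the two induction hypotheses are inserted.\<close>

lemma inner_bd_shuf:
  assumes "l \<in> \<Lambda>" "set as \<subseteq> carrier (G l)" "set bs \<subseteq> carrier (G l)"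
  shows "frag_extend inner_bd (shuf as bs)
    = frag_extend (\<lambda>c. shuf c bs) (inner_bd as)
      + frag_cmul ((-1) ^ length as) (frag_extend (shuf as) (inner_bd bs))"
  using assms
proof (induction as bs rule: shuf.induct)
  case (3 a as b bs)
  let ?e = "(-1) ^ length as :: int"
  have ab: "a \<in> carrier (G l)" "b \<in> carrier (G l)" "b \<in> X"
    using 3 carrier_subset_X[OF \<open>l \<in> \<Lambda>\<close>] by auto
  have lAb: "set (map (\<lambda>x. x \<star> b) (a # as)) \<subseteq> carrier (G l)"
    using 3 by (auto intro: star_in_group)
  have IH1: "frag_extend inner_bd (shuf as (b # bs))
    = frag_extend (\<lambda>c. shuf c (b # bs)) (inner_bd as)
      + frag_cmul ?e (frag_extend (shuf as) (inner_bd (b # bs)))"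
    using 3 by simp
  have IH2: "frag_extend inner_bd (shuf (map (\<lambda>x. x \<star> b) (a # as)) bs)
    = frag_extend (\<lambda>c. shuf (map (\<lambda>x. x \<star> b) c) bs) (inner_bd (a # as))
      - frag_cmul ?e (frag_extend (shuf (map (\<lambda>x. x \<star> b) (a # as))) (inner_bd bs))"
    using 3(2)[OF 3(3) lAb] 3(5) inner_bd_map_star[OF 3(3,4) ab(3)]
    by (simp add: frag_linear del: list.map(2) inner_bd.simps)
  \<comment> \<open>Terms \<open>c\<close> of \<open>inner_bd as\<close> are one shorter than
    \<open>as\<close>, so \<open>a # c\<close> has the length of \<open>as\<close> and moving
    \<open>b\<close> past it gives the sign \<open>?e\<close>.\<close>
  have left: "frag_extend (\<lambda>c. shuf (a # c) (b # bs)) (inner_bd as)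
    = push (Cons a) (frag_extend (\<lambda>c. shuf c (b # bs)) (inner_bd as))
      + frag_cmul ?e (push (Cons b)
          (frag_extend (\<lambda>c. shuf (map (\<lambda>x. x \<star> b) (a # c)) bs) (inner_bd as)))"
  proof -
    have "frag_extend (\<lambda>c. shuf (a # c) (b # bs)) (inner_bd as)
      = frag_extend (\<lambda>c. push (Cons a) (shuf c (b # bs))
      + frag_cmul ?e (push (Cons b) (shuf (map (\<lambda>x. x \<star> b) (a # c)) bs))) (inner_bd as)"
      using keys_inner_bd[of l as] 3 by (intro frag_extend_eq) fastforce
    then show ?thesis by (simp add: frag_linear)
  qed
  have left': "shuf (merge_head a as) (b # bs)
    = (case as of [] \<Rightarrow> 0 | a2 # as2 \<Rightarrow> push (Cons (gmult a a2)) (shuf as2 (b # bs)))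
      + frag_cmul ?e (push (Cons b) (shuf (map (\<lambda>x. x \<star> b) (merge_head a as)) bs))"
    by (cases as) auto
  \<comment> \<open>If \<open>b\<close> is merged with \<open>b2\<close>, the product acts as
    \<open>b\<close> followed by \<open>b2\<close>, by \<open>star_gmult\<close>.\<close>
  have right': "shuf (a # as) (merge_head b bs)
    = push (Cons a) (shuf as (merge_head b bs))
      + frag_cmul (- ?e) (case bs of [] \<Rightarrow> 0 | b2 # bs2 \<Rightarrow>
          push (Cons (gmult b b2)) (shuf (map (\<lambda>x. x \<star> b2) (map (\<lambda>x. x \<star> b) (a # as))) bs2))"
    using star_gmult[OF _ 3(3)] 3(4,5) carrier_subset_X[OF 3(3)] by (cases bs) (auto simp: subset_iff cong: map_cong)
  \<comment> \<open>This equation and \<open>merge_right\<close> isolate the block headed by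
    \<open>gmult a b\<close>, which enters \<open>lhs\<close> with coefficients \<open>- ?e\<close>
    and \<open>?e\<close>.\<close>
  have merge_left: "push (merge_head a) (shuf as (b # bs))
    = (case as of [] \<Rightarrow> 0 | a2 # as2 \<Rightarrow> push (Cons (gmult a a2)) (shuf as2 (b # bs)))
      + frag_cmul ?e (push (Cons (gmult a b)) (shuf (map (\<lambda>x. x \<star> b) as) bs))"
    by (cases as) (auto simp: frag_linear)
  have merge_right: "push (merge_head b) (shuf (map (\<lambda>x. x \<star> b) (a # as)) bs)
    = push (Cons (gmult a b)) (shuf (map (\<lambda>x. x \<star> b) as) bs)
      + frag_cmul (- ?e) (case bs of [] \<Rightarrow> 0 | b2 # bs2 \<Rightarrow>
          push (Cons (gmult b b2)) (shuf (map (\<lambda>x. x \<star> b2) (map (\<lambda>x. x \<star> b) (a # as))) bs2))"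
    using gmult_star_commute[OF 3(3) ab(1,2)] by (cases bs) (auto simp: frag_linear)
  \<comment> \<open>The remaining identity is linear in the blocks above; fixing the parity reduces
    it to additive cancellation.\<close>
  have "?e = 1 \<or> ?e = -1"
    by (metis neg_one_even_power neg_one_odd_power)
  have lhs: "frag_extend inner_bd (shuf (a # as) (b # bs)) =
     - push (merge_head a) (shuf as (b # bs)) - push (Cons a) (frag_extend inner_bd (shuf as (b # bs)))
     + frag_cmul ?e (push (merge_head b) (shuf (map (\<lambda>x. x \<star> b) (a # as)) bs)
        + push (Cons b) (frag_extend inner_bd (shuf (map (\<lambda>x. x \<star> b) (a # as)) bs)))"
    unfolding shuf.simps frag_extend_add frag_extend_cmul inner_bd_push_Cons
    by (simp add: frag_linear del: list.map)
  have rhs1: "frag_extend (\<lambda>c. shuf c (b # bs)) (inner_bd (a # as)) =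
    - shuf (merge_head a as) (b # bs) - frag_extend (\<lambda>c. shuf (a # c) (b # bs)) (inner_bd as)"
    by (simp add: frag_linear del: shuf.simps)
  have rhs2: "frag_extend (shuf (a # as)) (inner_bd (b # bs)) =
    - shuf (a # as) (merge_head b bs) - frag_extend (\<lambda>c. shuf (a # as) (b # c)) (inner_bd bs)"
    by (simp add: frag_linear del: shuf.simps)
  show ?case
    unfolding lhs rhs1 rhs2 IH1 IH2 left left' right' merge_left merge_right
    using \<open>?e = 1 \<or> ?e = -1\<close>
    by (simp, elim disjE) (simp_all add: frag_linear algebra_simps)
qed (simp_all add: push_id shuf_Nil1)

subsection \<open>The recursion computes the shuffle sum\<close>

text \<open>Position and rank both rise by one, so each i_k - k is unchanged, and the new position 1
  contributes 1 - 1 = 0.\<close>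

lemma shuffle_sign_insert:
  assumes "finite J" "0 \<notin> J"
  shows "shuffle_sign (insert 1 (Suc ` J)) = shuffle_sign J"
proof -
  have "1 \<notin> Suc ` J" using assms by auto
  moreover have "{j. (j = 1 \<or> j \<in> Suc ` J) \<and> j \<le> 1} = {1}" using assms by auto
  ultimately show ?thesis
    using assms card_insert_Suc_atMost[OF assms]
    by (simp add: shuffle_sign_def sum.reindex)
qed

text \<open>Positions rise but ranks do not, so each of the \<open>card J\<close> summands in the
  exponent grows by one.\<close>

lemma shuffle_sign_Suc:
  assumes "0 \<notin> J"
  shows "shuffle_sign (Suc ` J) = (-1) ^ card J * shuffle_sign J"
proof -
  have "(\<Sum>i\<in>J. Suc i - card {j \<in> J. j \<le> i}) = card J + (\<Sum>i\<in>J. i - card {j \<in> J. j \<le> i})"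
    using card_atMost_le[OF assms] by (simp add: Suc_diff_le sum_Suc)
  then show ?thesis
    by (simp add: shuffle_sign_def sum.reindex card_Suc_atMost power_add)
qed

lemma shuffle_tuple_insert:
  assumes "finite J" "0 \<notin> J"
  shows "shuffle_tuple (insert 1 (Suc ` J)) (a # as) bs = a # shuffle_tuple J as bs"
proof -
  have one: "{j. (j = 1 \<or> j \<in> Suc ` J) \<and> j \<le> 1} = {1}" using assms by auto
  have upt: "[1..<length (a # as) + length bs + 1] = 1 # map Suc [1..<length as + length bs + 1]"
    by (simp add: upt_conv_Cons map_Suc_upt del: upt_Suc)
  have nth: "(a # as) ! card {j \<in> J. j \<le> i} = as ! (card {j \<in> J. j \<le> i} - 1)" if "i \<in> J" for i
    using card_atMost_pos[OF assms(1) that] by (rule nth_Cons_pos)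
  have "Suc i \<in> insert 1 (Suc ` J) \<longleftrightarrow> i \<in> J" if "1 \<le> i" for i
    using that by auto
  then show ?thesis
    unfolding shuffle_tuple_def upt using one nth card_insert_Suc_atMost[OF assms]
    by (auto simp: Let_def simp del: upt_Suc)
qed

text \<open>\<open>gprod\<close> folds from the left while the recursion removes the leftmost
  factor; associativity moves that factor out of the fold.\<close>

lemma foldl_gmult:
  assumes "l \<in> \<Lambda>" "a \<in> carrier (G l)" "b \<in> carrier (G l)" "set cs \<subseteq> carrier (G l)"
  shows "foldl gmult (gmult a b) cs = gmult a (foldl gmult b cs)
    \<and> foldl gmult b cs \<in> carrier (G l)"
  using assms by (induction cs arbitrary: b) (auto simp: gmult_assoc gmult_closed)

lemma gprod_Cons:
  assumes "l \<in> \<Lambda>" "a \<in> carrier (G l)" "set bs \<subseteq> carrier (G l)" "bs \<noteq> []"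
  shows "gprod (a # bs) = gmult a (gprod bs)" "gprod bs \<in> carrier (G l)"
  using assms foldl_gmult[of l a "hd bs" "tl bs"] by (cases bs; simp add: gprod_def)+

text \<open>Every product that acts on an entry of \<open>as\<close> now begins with
  \<open>b\<close>, and a product acts as its first factor followed by the rest. Hence
  \<open>b\<close> can act on all of \<open>as\<close> beforehand.\<close>

lemma shuffle_tuple_Suc:
  assumes J: "J \<subseteq> {1..length as + length bs}" "card J = length as"
    and G: "l \<in> \<Lambda>" "set as \<subseteq> carrier (G l)" "b \<in> carrier (G l)" "set bs \<subseteq> carrier (G l)"
  shows "shuffle_tuple (Suc ` J) as (b # bs) = b # shuffle_tuple J (map (\<lambda>x. x \<star> b) as) bs"
proof -
  have J': "finite J" "0 \<notin> J" using J finite_subset by auto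
  have one: "{j \<in> Suc ` J. j \<le> 1} = {}" using J' by auto
  have upt: "[1..<length as + length (b # bs) + 1] = 1 # map Suc [1..<length as + length bs + 1]"
    by (simp add: upt_conv_Cons map_Suc_upt del: upt_Suc)
  have "(let k = card {j \<in> Suc ` J. j \<le> Suc i} in
            if Suc i \<in> Suc ` J
            then (if Suc i = k then as ! (k - 1) else as ! (k - 1) \<star> gprod (take (Suc i - k) (b # bs)))
            else (b # bs) ! (Suc i - k - 1)) =
       (let k = card {j \<in> J. j \<le> i} in
            if i \<in> J
            then (if i = k then map (\<lambda>x. x \<star> b) as ! (k - 1)
              else map (\<lambda>x. x \<star> b) as ! (k - 1) \<star> gprod (take (i - k) bs))
            else bs ! (i - k - 1))" if i: "1 \<le> i" "i \<le> length as + length bs" for i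
  proof -
    define k where "k = card {j \<in> J. j \<le> i}"
    have ki: "k \<le> i" using card_atMost_le[OF J'(2)] by (simp add: k_def)
    show ?thesis
    proof (cases "i \<in> J")
      case False
      then have "k < i" using card_atMost_less[OF J'(2) False] i by (simp add: k_def)
      with False show ?thesis
        using card_Suc_atMost[of J i] by (simp add: inj_image_mem_iff Suc_diff_le nth_Cons' flip: k_def)
    next
      case True
      have k0: "0 < k" using card_atMost_pos[OF J'(1) True] by (simp add: k_def)
      have ks: "k \<le> length as"
        using card_mono[OF J'(1), of "{j \<in> J. j \<le> i}"] J by (auto simp: k_def)
      have a: "as ! (k - 1) \<in> carrier (G l)" using G(2) k0 ks by (simp add: subset_iff)
      have nth: "map (\<lambda>x. x \<star> b) as ! (k - 1) = as ! (k - 1) \<star> b" using k0 ks by simp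
      \<comment> \<open>\<open>gprod []\<close> has no meaning and must not occur. If
        \<open>bs\<close> is empty, \<open>J\<close> consists of all positions, so every position
        equals its rank.\<close>
      have "bs \<noteq> []" if "i \<noteq> k"
      proof
        assume "bs = []"
        with J have "J = {1..length as}" by (intro card_subset_eq) auto
        moreover have "i \<le> length as" using i \<open>bs = []\<close> by simp
        ultimately have "{j \<in> J. j \<le> i} = {1..i}" by auto
        with that show False by (simp add: k_def)
      qed
      then have "as ! (k - 1) \<star> gprod (take (Suc i - k) (b # bs))
        = (if i = k then as ! (k - 1) \<star> b else as ! (k - 1) \<star> b \<star> gprod (take (i - k) bs))"
        using ki a G gprod_Cons[of l b "take (i - k) bs"] set_take_subset[of "i - k" bs]
          carrier_subset_X[of l] star_gmult[of "as ! (k - 1)" l b "gprod (take (i - k) bs)"]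
        by (auto simp: Suc_diff_le gprod_def[of "[b]"])
      with True nth ki show ?thesis
        using card_Suc_atMost[of J i] by (simp add: inj_image_mem_iff flip: k_def)
    qed
  qed
  then show ?thesis
    unfolding shuffle_tuple_def upt using one J'(2) by (simp add: Let_def inj_image_mem_iff del: upt_Suc)
qed

lemma frag_extend_shuffle:
  "frag_extend f (shuffle as bs) = (\<Sum>I | I \<subseteq> {1..length as + length bs} \<and> card I = length as.
        frag_cmul (shuffle_sign I) (f (shuffle_tuple I as bs)))"
  by (simp add: shuffle_def frag_extend_sum frag_extend_cmul comp_def)

lemma shuffle_Nil1: "shuffle [] bs = frag_of bs"
proof -
  have "{I. I \<subseteq> {1..length bs} \<and> card I = 0} = {{}}"
    by (auto dest: finite_subset)
  moreover have "shuffle_tuple {} [] bs = bs"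
    by (auto simp: shuffle_tuple_def intro: nth_equalityI simp del: upt_Suc)
  ultimately show ?thesis by (simp add: shuffle_def shuffle_sign_def)
qed

lemma shuffle_Nil2: "shuffle as [] = frag_of as"
proof -
  have S: "{I. I \<subseteq> {1..length as} \<and> card I = length as} = {{1..length as}}"
    using card_subset_eq[of "{1..length as}"] by auto
  have "{j. Suc 0 \<le> j \<and> j \<le> length as \<and> j \<le> i} = {1..i}" if "i \<le> length as" for i
    using that by auto
  then have "shuffle_tuple {1..length as} as [] = as"
    and "shuffle_sign {1..length as} = 1"
    by (auto simp: shuffle_tuple_def shuffle_sign_def intro!: nth_equalityI simp del: upt_Suc)
  then show ?thesis by (simp add: shuffle_def S del: One_nat_def)
qed

text \<open>Splitting the index sets by \<open>sum_subsets_Suc\<close> turns the explicit sum into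
  the two terms of \<open>shuf\<close>; the extra sign of the second is that of
  \<open>shuffle_sign_Suc\<close>.\<close>

lemma shuffle_eq_shuf:
  assumes "l \<in> \<Lambda>" "set as \<subseteq> carrier (G l)" "set bs \<subseteq> carrier (G l)"
  shows "shuffle as bs = shuf as bs"
  using assms
proof (induction as bs rule: shuf.induct)
  case (3 a as b bs)
  let ?A = "map (\<lambda>x. x \<star> b) (a # as)" and ?n = "length as + length (b # bs)"
  have A: "set ?A \<subseteq> carrier (G l)"
    using 3 by (auto intro: star_in_group)
  have len: "length (a # as) + length (b # bs) = Suc ?n" "length ?A + length bs = ?n" by simp_all
  have *: "finite J" "0 \<notin> J" if "J \<subseteq> {1..?n}" for J
    using that finite_subset by auto
  have "shuffle (a # as) (b # bs)
    = (\<Sum>J | J \<subseteq> {1..?n} \<and> card J = length as.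
        frag_cmul (shuffle_sign J) (frag_of (a # shuffle_tuple J as (b # bs))))
     + (\<Sum>J | J \<subseteq> {1..?n} \<and> card J = length ?A.
        frag_cmul (shuffle_sign (Suc ` J)) (frag_of (shuffle_tuple (Suc ` J) (a # as) (b # bs))))"
    unfolding shuffle_def len unfolding length_Cons[of a] sum_subsets_Suc
    using * by (intro arg_cong2[of _ _ _ _ "(+)"] sum.cong)
      (auto simp: shuffle_tuple_insert shuffle_sign_insert simp del: One_nat_def)
  also have "\<dots> = push (Cons a) (shuffle as (b # bs))
      + frag_cmul ((-1) ^ Suc (length as)) (push (Cons b) (shuffle ?A bs))"
    unfolding frag_extend_shuffle frag_cmul_sum len
    using * 3(3-5) by (intro arg_cong2[of _ _ _ _ "(+)"] sum.cong)
      (auto simp: shuffle_tuple_Suc[where l = l] shuffle_sign_Suc simp del: list.map)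
  finally show ?case using 3(1)[OF 3(3) _ 3(5)] 3(2)[OF 3(3) A] 3(4,5) by simp
qed (simp_all add: shuffle_Nil1 shuffle_Nil2)

subsection \<open>Boundaries of degeneracies\<close>

text \<open>Merging the first two entries is the term i = 1. The other terms come from the tail,
  where prefixing an entry shifts \<open>i\<close> by one and flips the sign.\<close>

lemma inner_bd_eq_sum:
  assumes "c \<noteq> []"
  shows "inner_bd c =
    (\<Sum>i = 1..<length c. frag_cmul ((-1) ^ i)
        (frag_of (take (i - 1) c @ [gmult (c ! (i - 1)) (c ! i)] @ drop (i + 1) c)))
    + frag_cmul ((-1) ^ length c) (frag_of (butlast c))"
  using assms
proof (induction c)
  case (Cons x d)
  show ?case
  proof (cases d)
    case Nil
    then show ?thesis by simp
  next
    case (Cons y zs)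
    let ?t = "\<lambda>c i. frag_cmul ((-1) ^ i)
        (frag_of (take (i - 1) c @ [gmult (c ! (i - 1)) (c ! i)] @ drop (i + 1) c)) :: 'a list \<Rightarrow>\<^sub>0 int"
    have "(\<Sum>i = 1..<length (x # d). ?t (x # d) i) = ?t (x # d) 1 + (\<Sum>i = 1..<length d. ?t (x # d) (Suc i))"
      using Cons by (simp add: sum.atLeast_Suc_lessThan sum.shift_bounds_Suc_ivl del: sum.op_ivl_Suc)
    also have "(\<Sum>i = 1..<length d. ?t (x # d) (Suc i)) = (\<Sum>i = 1..<length d. - push (Cons x) (?t d i))"
    proof (rule sum.cong)
      fix i assume "i \<in> {1..<length d}"
      then show "?t (x # d) (Suc i) = - push (Cons x) (?t d i)"
        by (cases i) (simp_all add: frag_extend_cmul)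
    qed simp
    also have "\<dots> = - push (Cons x) (\<Sum>i = 1..<length d. ?t d i)"
      by (simp add: frag_extend_sum sum_negf comp_def)
    finally show ?thesis
      using Cons.IH \<open>d = y # zs\<close> by (simp add: frag_linear del: sum.op_ivl_Suc)
  qed
qed simp

definition valid_factors :: "'a list list \<Rightarrow> bool" where
  "valid_factors fs \<longleftrightarrow> (\<forall>as \<in> set fs. as \<noteq> [] \<and> in_one_group (set as))"

lemma valid_factors_simps [simp]:
  "valid_factors []"
  "valid_factors (as # fs) \<longleftrightarrow> as \<noteq> [] \<and> in_one_group (set as) \<and> valid_factors fs"
  "valid_factors (fs @ gs) \<longleftrightarrow> valid_factors fs \<and> valid_factors gs"
  by (auto simp: valid_factors_def)

lemma valid_factors_star:
  "x \<in> X \<Longrightarrow> valid_factors fs \<Longrightarrow> valid_factors (map (map (\<lambda>a. a \<star> x)) fs)"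
  by (auto simp: valid_factors_def in_one_group_star)

abbreviation weight :: "'a list list \<Rightarrow> nat" where
  "weight fs \<equiv> sum_list (map length fs)"

lemma weight_star [simp]: "sum_list (map (length \<circ> map f) fs) = weight fs"
  by (simp add: comp_def)

end

section \<open>Chains, and degeneracy elements with possibly empty factors\<close>

context mcq_set
begin

lemma factor_simps [simp]: "factor [] = []" "as \<noteq> [] \<Longrightarrow> factor as = [as]"
  by (simp_all add: factor_def)

lemma valid_factors_factor [simp]: "valid_factors (factor as) \<longleftrightarrow> as = [] \<or> in_one_group (set as)"
  by (simp add: factor_def)

lemma weight_factor [simp]: "weight (factor as) = length as"
  by (simp add: factor_def)

text \<open>Only the first term touches \<open>y\<close> and \<open>pre\<close>.
  \<open>factor c\<close> deletes an empty factor, which arises only when \<open>as\<close> has a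
  single entry.\<close>

lemma factor_boundary_eq:
  assumes "as \<noteq> []"
  shows "factor_boundary y pre as post =
    frag_of (y \<star>\<^sub>Y hd as, map (map (\<lambda>x. x \<star> hd as)) pre @ factor (tl as) @ post)
    + push (\<lambda>c. (y, pre @ factor c @ post)) (inner_bd as)"
  using assms
  by (simp add: factor_boundary_def inner_bd_eq_sum frag_extend_add frag_extend_sum
      frag_extend_cmul comp_def add.assoc)

lemma prism_gens_iff:
  "(y, fs) \<in> prism_gens n \<longleftrightarrow> y \<in> Y \<and> valid_factors fs \<and> int (weight fs) = n"
  by (simp add: prism_gens_def valid_factors_def)

text \<open>\<open>factor\<close> lets \<open>as\<close> or \<open>bs\<close> be empty, and the
  element is then 0. Boundary terms that empty one of the two factors thus need no special
  treatment.\<close>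

definition degen_elt ::
  "'y \<Rightarrow> 'a list list \<Rightarrow> 'a list \<Rightarrow> 'a list \<Rightarrow> 'a list list \<Rightarrow> ('y \<times> 'a list list) \<Rightarrow>\<^sub>0 int" where
  "degen_elt y pre as bs post =
     frag_of (y, pre @ factor as @ factor bs @ post)
     - push (\<lambda>c. (y, pre @ factor c @ post)) (shuf as bs)"

lemma in_one_groupE:
  assumes "in_one_group (set as \<union> set bs)"
  obtains l where "l \<in> \<Lambda>" "set as \<subseteq> carrier (G l)" "set bs \<subseteq> carrier (G l)"
  using assms by (auto simp: in_one_group_def)

lemma keys_shuf_one_group:
  assumes "in_one_group (set as \<union> set bs)" "c \<in> Poly_Mapping.keys (shuf as bs)"
  shows "length c = length as + length bs" "in_one_group (set c)"
  using assms by (auto elim!: in_one_groupE dest: keys_shuf simp: in_one_group_def)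

lemma keys_shuf_nonempty:
  assumes "in_one_group (set as \<union> set bs)" "as \<noteq> []" "c \<in> Poly_Mapping.keys (shuf as bs)"
  shows "c \<noteq> []"
  using keys_shuf_one_group(1)[OF assms(1,3)] assms(2) by auto

lemma keys_inner_bd_one_group:
  assumes "in_one_group (set as)" "c \<in> Poly_Mapping.keys (inner_bd as)"
  shows "Suc (length c) = length as" "in_one_group (set c)"
  using assms by (auto dest: keys_inner_bd simp: in_one_group_def)

lemma keys_inner_bd_union_one_group:
  assumes "in_one_group (set as \<union> S)" "c \<in> Poly_Mapping.keys (inner_bd as)"
  shows "in_one_group (set c \<union> S)"
  using assms by (auto dest: keys_inner_bd simp: in_one_group_def)

lemma degen_elt_eq:
  assumes "as \<noteq> []" "bs \<noteq> []" "in_one_group (set as \<union> set bs)"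
  shows "degen_elt y pre as bs post = frag_of (y, pre @ [as, bs] @ post)
        - frag_extend (\<lambda>cs. frag_of (y, pre @ [cs] @ post)) (shuffle as bs)"
proof -
  have "shuffle as bs = shuf as bs"
    using assms(3) by (auto elim!: in_one_groupE simp: shuffle_eq_shuf)
  moreover have "push (\<lambda>c. (y, pre @ factor c @ post)) (shuf as bs)
    = push (\<lambda>c. (y, pre @ [c] @ post)) (shuf as bs)"
    using keys_shuf_nonempty[OF assms(3,1)] by (intro frag_extend_eq) simp
  ultimately show ?thesis using assms by (simp add: degen_elt_def)
qed

lemma degen_gens_eq:
  "degen_gens n = {degen_elt y pre as bs post | y pre as bs post.
     y \<in> Y \<and> valid_factors (pre @ post) \<and> as \<noteq> [] \<and> bs \<noteq> [] \<and> in_one_group (set as \<union> set bs) \<and>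
     int (weight pre + length as + length bs + weight post) = n}"
proof -
  have valid: "(y, pre @ [as, bs] @ post) \<in> prism_gens n \<and> in_one_group (set as \<union> set bs) \<longleftrightarrow>
     y \<in> Y \<and> valid_factors (pre @ post) \<and> as \<noteq> [] \<and> bs \<noteq> [] \<and> in_one_group (set as \<union> set bs) \<and>
     int (weight pre + length as + length bs + weight post) = n" (is "?P y pre as bs post \<longleftrightarrow> ?Q y pre as bs post")
    for y pre as bs post
    by (auto simp: prism_gens_iff intro: in_one_group_subset)
  have "x = frag_of (y, pre @ [as, bs] @ post)
        - frag_extend (\<lambda>cs. frag_of (y, pre @ [cs] @ post)) (shuffle as bs) \<and> ?P y pre as bs post \<longleftrightarrow>
      x = degen_elt y pre as bs post \<and> ?Q y pre as bs post" for x y pre as bs post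
    using valid[of y pre as bs post] degen_elt_eq[of as bs y pre post] by argo
  then show ?thesis
    unfolding degen_gens_def by (intro Collect_cong ex_cong1)
qed

lemma degen_gens_carrier: "degen_gens n \<subseteq> carrier (prism_chains n)"
proof
  fix x assume "x \<in> degen_gens n"
  then obtain y pre as bs post where x: "x = degen_elt y pre as bs post"
    and *: "y \<in> Y" "valid_factors (pre @ post)" "as \<noteq> []" "bs \<noteq> []" "in_one_group (set as \<union> set bs)"
      "int (weight pre + length as + length bs + weight post) = n"
    by (auto simp: degen_gens_eq)
  have "in_one_group (set as)" "in_one_group (set bs)"
    using *(5) by (auto intro: in_one_group_subset)
  then have "(y, pre @ factor as @ factor bs @ post) \<in> prism_gens n"
    using * by (simp add: prism_gens_iff)
  moreover have "(\<lambda>c. (y, pre @ factor c @ post)) ` Poly_Mapping.keys (shuf as bs) \<subseteq> prism_gens n"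
    using * keys_shuf_one_group[OF *(5)] by (auto simp: prism_gens_iff)
  ultimately show "x \<in> carrier (prism_chains n)"
    unfolding x degen_elt_def prism_chains_def carrier_free_Abelian_group_iff
    by (intro order.trans[OF keys_diff] Un_least order.trans[OF keys_push]) (simp_all add: keys_frag_of)
qed

section \<open>Closure properties of the degenerate chains\<close>

lemma subgroup_degen_chains: "subgroup (degen_chains n) (prism_chains n)"
  unfolding degen_chains_def prism_chains_def
  by (rule group.generate_is_subgroup[OF group_free_Abelian_group degen_gens_carrier[unfolded prism_chains_def]])

lemma degen_zero: "0 \<in> degen_chains n"
  using subgroup.one_closed[OF subgroup_degen_chains] by (simp add: prism_chains_def)

lemma degen_add: "a \<in> degen_chains n \<Longrightarrow> b \<in> degen_chains n \<Longrightarrow> a + b \<in> degen_chains n"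
  using subgroup.m_closed[OF subgroup_degen_chains] by (simp add: prism_chains_def)

lemma degen_minus: "a \<in> degen_chains n \<Longrightarrow> - a \<in> degen_chains n"
  using subgroup.m_inv_closed[OF subgroup_degen_chains, of a n]
    subgroup.subset[OF subgroup_degen_chains, of n]
  by (auto simp: prism_chains_def subset_iff)

lemma degen_diff: "a \<in> degen_chains n \<Longrightarrow> b \<in> degen_chains n \<Longrightarrow> a - b \<in> degen_chains n"
  using degen_add[of a n "- b"] degen_minus by simp

lemma degen_cmul: "a \<in> degen_chains n \<Longrightarrow> frag_cmul k a \<in> degen_chains n"
  by (rule frag_closure_minus_cmul[of "\<lambda>a. a \<in> degen_chains n"]) (auto intro: degen_zero degen_diff)

lemma degen_sum: "(\<And>i. i \<in> I \<Longrightarrow> f i \<in> degen_chains n) \<Longrightarrow> sum f I \<in> degen_chains n"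
  by (induction I rule: infinite_finite_induct) (auto intro: degen_zero degen_add)

lemma degen_frag_extend:
  "(\<And>x. x \<in> Poly_Mapping.keys c \<Longrightarrow> f x \<in> degen_chains n) \<Longrightarrow> frag_extend f c \<in> degen_chains n"
  unfolding frag_extend_def by (intro degen_sum degen_cmul)

lemma degen_elt_in:
  assumes "y \<in> Y" "valid_factors pre" "valid_factors post" "in_one_group (set as \<union> set bs)"
    and "int (weight pre + length as + length bs + weight post) = n"
  shows "degen_elt y pre as bs post \<in> degen_chains n"
proof (cases "as = [] \<or> bs = []")
  case True
  then have "degen_elt y pre as bs post = 0"
    by (auto simp: degen_elt_def)
  then show ?thesis by (simp add: degen_zero)
next
  case False
  then have "degen_elt y pre as bs post \<in> degen_gens n"
    using assms unfolding degen_gens_eq by fastforce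
  then show ?thesis by (simp add: degen_chains_def generate.incl)
qed

section \<open>Boundary contributions of the factors before, after and inside the shuffled
  pair\<close>

lemma factor_boundary_before:
  assumes y: "y \<in> Y" and c: "c \<noteq> []" "in_one_group (set c)"
    and v: "valid_factors p" "valid_factors q" "valid_factors post"
    and ab: "as \<noteq> []" "bs \<noteq> []" "in_one_group (set as \<union> set bs)"
    and n: "int (weight p + length c + weight q + length as + length bs + weight post) = n"
  shows "factor_boundary y p c (q @ [as, bs] @ post)
    - frag_extend (\<lambda>d. factor_boundary y p c (q @ [d] @ post)) (shuf as bs) \<in> degen_chains (n - 1)"
proof -
  let ?y = "y \<star>\<^sub>Y hd c" and ?p = "map (map (\<lambda>x. x \<star> hd c)) p"
  have x: "hd c \<in> X" using c in_one_group_X by (meson hd_in_set subsetD)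
  have tl: "tl c = [] \<or> in_one_group (set (tl c))"
    using c by (meson in_one_group_subset list.set_sel(2) subsetI)
  have "frag_extend (\<lambda>d. factor_boundary y p c (q @ [d] @ post)) (shuf as bs)
    = frag_extend (\<lambda>d. frag_of (?y, ?p @ factor (tl c) @ q @ factor d @ post)
        + push (\<lambda>e. (y, p @ factor e @ q @ factor d @ post)) (inner_bd c)) (shuf as bs)"
    using keys_shuf_nonempty[OF ab(3,1)] c by (intro frag_extend_eq) (simp add: factor_boundary_eq)
  also have "\<dots> = push (\<lambda>d. (?y, ?p @ factor (tl c) @ q @ factor d @ post)) (shuf as bs)
      + frag_extend (\<lambda>e. push (\<lambda>d. (y, p @ factor e @ q @ factor d @ post)) (shuf as bs)) (inner_bd c)"
    by (simp only: frag_extend_fun_add frag_extend_swap[of _ "inner_bd c" "shuf as bs"])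
  \<comment> \<open>A factor left of the pair acts only on what stands further left, so its boundary
    commutes with shuffling and leaves \<open>as\<close> and \<open>bs\<close> unchanged.\<close>
  finally have "factor_boundary y p c (q @ [as, bs] @ post)
      - frag_extend (\<lambda>d. factor_boundary y p c (q @ [d] @ post)) (shuf as bs)
    = degen_elt ?y (?p @ factor (tl c) @ q) as bs post
      + frag_extend (\<lambda>e. degen_elt y (p @ factor e @ q) as bs post) (inner_bd c)"
    using c ab by (simp add: factor_boundary_eq degen_elt_def frag_extend_fun_diff)
  also have "\<dots> \<in> degen_chains (n - 1)"
  proof (intro degen_add degen_frag_extend)
    show "degen_elt ?y (?p @ factor (tl c) @ q) as bs post \<in> degen_chains (n - 1)"
      using y c v ab n x tl by (intro degen_elt_in) (auto simp: act_closed valid_factors_star of_nat_diff Suc_le_eq)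
    fix e assume "e \<in> Poly_Mapping.keys (inner_bd c)"
    from keys_inner_bd_one_group[OF c(2) this] y c v ab n
    show "degen_elt y (p @ factor e @ q) as bs post \<in> degen_chains (n - 1)"
      by (intro degen_elt_in) auto
  qed
  finally show ?thesis .
qed

text \<open>Here the first boundary term lets \<open>hd c\<close> act on the pair as well. By
  \<open>shuf_map_star\<close> the acted shuffle is the shuffle of the acted factors, so this term
  is again a degeneracy element.\<close>

lemma factor_boundary_after:
  assumes y: "y \<in> Y" and c: "c \<noteq> []" "in_one_group (set c)"
    and v: "valid_factors pre" "valid_factors p" "valid_factors q"
    and ab: "as \<noteq> []" "bs \<noteq> []" "in_one_group (set as \<union> set bs)"
    and n: "int (weight pre + length as + length bs + weight p + length c + weight q) = n"
  shows "factor_boundary y (pre @ [as, bs] @ p) c q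
    - frag_extend (\<lambda>d. factor_boundary y (pre @ [d] @ p) c q) (shuf as bs) \<in> degen_chains (n - 1)"
proof -
  let ?s = "map (\<lambda>x. x \<star> hd c)"
  let ?y = "y \<star>\<^sub>Y hd c" and ?pre = "map ?s pre" and ?p = "map ?s p"
  have x: "hd c \<in> X" using c in_one_group_X by (meson hd_in_set subsetD)
  have tl: "tl c = [] \<or> in_one_group (set (tl c))"
    using c by (meson in_one_group_subset list.set_sel(2) subsetI)
  have star: "in_one_group (set (?s as) \<union> set (?s bs))"
    using in_one_group_star[OF x ab(3)] by (simp add: image_Un)
  have shuf_star: "shuf (?s as) (?s bs) = push ?s (shuf as bs)"
    using in_one_group_X[OF ab(3)] x by (intro shuf_map_star) auto
  have "frag_extend (\<lambda>d. factor_boundary y (pre @ [d] @ p) c q) (shuf as bs)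
    = frag_extend (\<lambda>d. frag_of (?y, ?pre @ factor (?s d) @ ?p @ factor (tl c) @ q)
        + push (\<lambda>e. (y, pre @ factor d @ p @ factor e @ q)) (inner_bd c)) (shuf as bs)"
    using keys_shuf_nonempty[OF ab(3,1)] c by (intro frag_extend_eq) (simp add: factor_boundary_eq)
  also have "\<dots> = push (\<lambda>d. (?y, ?pre @ factor (?s d) @ ?p @ factor (tl c) @ q)) (shuf as bs)
      + frag_extend (\<lambda>e. push (\<lambda>d. (y, pre @ factor d @ p @ factor e @ q)) (shuf as bs)) (inner_bd c)"
    by (simp only: frag_extend_fun_add frag_extend_swap[of _ "inner_bd c" "shuf as bs"])
  finally have "factor_boundary y (pre @ [as, bs] @ p) c q
      - frag_extend (\<lambda>d. factor_boundary y (pre @ [d] @ p) c q) (shuf as bs)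
    = degen_elt ?y ?pre (?s as) (?s bs) (?p @ factor (tl c) @ q)
      + frag_extend (\<lambda>e. degen_elt y pre as bs (p @ factor e @ q)) (inner_bd c)"
    using c ab by (simp add: factor_boundary_eq degen_elt_def frag_extend_fun_diff shuf_star
        frag_extend_compose)
  also have "\<dots> \<in> degen_chains (n - 1)"
  proof (intro degen_add degen_frag_extend)
    show "degen_elt ?y ?pre (?s as) (?s bs) (?p @ factor (tl c) @ q) \<in> degen_chains (n - 1)"
      using y c v ab n x tl star
      by (intro degen_elt_in) (auto simp: act_closed valid_factors_star of_nat_diff Suc_le_eq)
    fix e assume "e \<in> Poly_Mapping.keys (inner_bd c)"
    from keys_inner_bd_one_group[OF c(2) this] y c v ab n
    show "degen_elt y pre as bs (p @ factor e @ q) \<in> degen_chains (n - 1)"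
      by (intro degen_elt_in) auto
  qed
  finally show ?thesis .
qed

text \<open>Four kinds of terms remain: \<open>as\<close> or \<open>bs\<close> loses its first
  entry, which acts on everything to its left, or one of them is replaced by a term of its inner
  boundary. Each is a degeneracy element, zero if a factor has become empty.\<close>

lemma factor_boundary_shuffle:
  assumes y: "y \<in> Y" and v: "valid_factors pre" "valid_factors post"
    and ab: "as \<noteq> []" "bs \<noteq> []" "in_one_group (set as \<union> set bs)"
    and n: "int (weight pre + length as + length bs + weight post) = n"
  shows "factor_boundary y pre as ([bs] @ post)
    + frag_cmul ((-1) ^ length as) (factor_boundary y (pre @ [as]) bs post)
    - frag_extend (\<lambda>d. factor_boundary y pre d post) (shuf as bs) \<in> degen_chains (n - 1)"
proof -
  obtain l where l: "l \<in> \<Lambda>" "set as \<subseteq> carrier (G l)" "set bs \<subseteq> carrier (G l)"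
    using ab(3) by (rule in_one_groupE)
  obtain a as' b bs' where as: "as = a # as'" and bs: "bs = b # bs'"
    using ab by (meson list.exhaust)
  let ?e = "(-1) ^ length as :: int"
  let ?s = "\<lambda>x. map (\<lambda>a. a \<star> x)"
  let ?lead = "\<lambda>d. frag_of (y \<star>\<^sub>Y hd d, map (?s (hd d)) pre @ factor (tl d) @ post)"
  let ?inner = "\<lambda>d. push (\<lambda>c. (y, pre @ factor c @ post)) (inner_bd d)"
  have X: "a \<in> X" "b \<in> X" using l as bs carrier_subset_X by auto
  have groups: "in_one_group (set as' \<union> set bs)" "in_one_group (set (?s b as) \<union> set bs')"
    using l as bs star_in_group[OF l(1)] by (auto simp: in_one_group_def intro!: bexI[of _ l])
  have "frag_extend (\<lambda>d. factor_boundary y pre d post) (shuf as bs)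
    = frag_extend (\<lambda>d. ?lead d + ?inner d) (shuf as bs)"
    using keys_shuf_nonempty[OF ab(3,1)] by (intro frag_extend_eq) (simp add: factor_boundary_eq)
  also have "\<dots> = frag_extend ?lead (shuf as bs)
      + push (\<lambda>c. (y, pre @ factor c @ post)) (frag_extend inner_bd (shuf as bs))"
    by (simp only: frag_extend_fun_add frag_extend_compose)
  \<comment> \<open>A shuffled tuple begins with \<open>a\<close> or \<open>b\<close>. Removing that
    entry leaves a shuffle of \<open>as'\<close> with \<open>bs\<close>, or of the acted
    \<open>as\<close> with \<open>bs'\<close>: the shuffles that belong to the first boundary terms
    of \<open>as\<close> and of \<open>bs\<close>.\<close>
  also have "frag_extend ?lead (shuf as bs)
    = push (\<lambda>d. (y \<star>\<^sub>Y a, map (?s a) pre @ factor d @ post)) (shuf as' bs)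
      + frag_cmul ?e (push (\<lambda>d. (y \<star>\<^sub>Y b, map (?s b) pre @ factor d @ post)) (shuf (?s b as) bs'))"
    by (simp add: as bs frag_linear del: list.map(2))
  finally have "factor_boundary y pre as ([bs] @ post)
      + frag_cmul ?e (factor_boundary y (pre @ [as]) bs post)
      - frag_extend (\<lambda>d. factor_boundary y pre d post) (shuf as bs)
    = degen_elt (y \<star>\<^sub>Y a) (map (?s a) pre) as' bs post
      + frag_cmul ?e (degen_elt (y \<star>\<^sub>Y b) (map (?s b) pre) (?s b as) bs' post)
      + frag_extend (\<lambda>d. degen_elt y pre d bs post) (inner_bd as)
      + frag_cmul ?e (frag_extend (\<lambda>d. degen_elt y pre as d post) (inner_bd bs))"
    unfolding inner_bd_shuf[OF l]
    using ab by (simp add: factor_boundary_eq degen_elt_def as bs frag_linear del: inner_bd.simps shuf.simps)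
  also have "\<dots> \<in> degen_chains (n - 1)"
  proof (intro degen_add degen_cmul degen_frag_extend)
    show "degen_elt (y \<star>\<^sub>Y a) (map (?s a) pre) as' bs post \<in> degen_chains (n - 1)"
      using y v n X groups as by (intro degen_elt_in) (auto simp: act_closed valid_factors_star)
    show "degen_elt (y \<star>\<^sub>Y b) (map (?s b) pre) (?s b as) bs' post \<in> degen_chains (n - 1)"
      using y v n X groups bs by (intro degen_elt_in) (auto simp: act_closed valid_factors_star)
    have one: "in_one_group (set as)" "in_one_group (set bs)"
      using ab(3) by (auto intro: in_one_group_subset)
    fix d
    show "degen_elt y pre d bs post \<in> degen_chains (n - 1)" if d: "d \<in> Poly_Mapping.keys (inner_bd as)"
      using y v n keys_inner_bd_one_group[OF one(1) d] keys_inner_bd_union_one_group[OF ab(3) d]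
      by (intro degen_elt_in) auto
    show "degen_elt y pre as d post \<in> degen_chains (n - 1)" if d: "d \<in> Poly_Mapping.keys (inner_bd bs)"
      using y v n keys_inner_bd_one_group[OF one(2) d]
        keys_inner_bd_union_one_group[of bs "set as" d] ab(3) d
      by (intro degen_elt_in) (auto simp: Un_commute)
  qed
  finally show ?thesis .
qed

text \<open>The boundary is a sum over positions before, inside and after the pair, and each part is
  handled by its own lemma above once the signs are seen to agree.\<close>

lemma boundary_degen_elt:
  assumes y: "y \<in> Y" and v: "valid_factors pre" "valid_factors post"
    and ab: "as \<noteq> []" "bs \<noteq> []" "in_one_group (set as \<union> set bs)"
    and n: "int (weight pre + length as + length bs + weight post) = n"
  shows "boundary (degen_elt y pre as bs post) \<in> degen_chains (n - 1)"
proof -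
  define T where "T us f vs = frag_cmul ((-1) ^ weight us) (factor_boundary y us f vs)" for us f vs
  let ?S = "shuf as bs"
  have gen: "gen_boundary (y, fs) = (\<Sum>i<length fs. T (take i fs) (fs ! i) (drop (Suc i) fs))" for fs
    by (simp add: gen_boundary_def T_def)
  let ?pre = "\<lambda>mid i. T (take i pre) (pre ! i) (drop (Suc i) pre @ mid @ post)"
  let ?post = "\<lambda>mid i. T (pre @ mid @ take i post) (post ! i) (drop (Suc i) post)"
  have split: "gen_boundary (y, pre @ mid @ post) = (\<Sum>i<length pre. ?pre mid i)
      + (\<Sum>i<length mid. T (pre @ take i mid) (mid ! i) (drop (Suc i) mid @ post))
      + (\<Sum>i<length post. ?post mid i)" for mid
    unfolding gen sum_splits_append[of T] sum_splits_append[of "\<lambda>u. T (pre @ u)"]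
    by (simp add: add.assoc)
  have S: "d \<noteq> []" "length d = length as + length bs" if "d \<in> Poly_Mapping.keys ?S" for d
    using keys_shuf_one_group(1)[OF ab(3) that] ab(1) by auto
  have "boundary (degen_elt y pre as bs post) = gen_boundary (y, pre @ [as, bs] @ post)
      - frag_extend (\<lambda>d. gen_boundary (y, pre @ factor d @ post)) ?S"
    using ab by (simp add: degen_elt_def boundary_def frag_linear)
  \<comment> \<open>A shuffle of a nonempty \<open>as\<close> is nonempty, so
    \<open>factor d\<close> is just \<open>[d]\<close>.\<close>
  also have "frag_extend (\<lambda>d. gen_boundary (y, pre @ factor d @ post)) ?S
    = frag_extend (\<lambda>d. gen_boundary (y, pre @ [d] @ post)) ?S"
    using S by (intro frag_extend_eq) simp
  also have "gen_boundary (y, pre @ [as, bs] @ post)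
      - frag_extend (\<lambda>d. gen_boundary (y, pre @ [d] @ post)) ?S
    = (\<Sum>i<length pre. ?pre [as, bs] i - frag_extend (\<lambda>d. ?pre [d] i) ?S)
      + (T pre as ([bs] @ post) + T (pre @ [as]) bs post - frag_extend (\<lambda>d. T pre d post) ?S)
      + (\<Sum>i<length post. ?post [as, bs] i - frag_extend (\<lambda>d. ?post [d] i) ?S)"
    unfolding split
    by (simp add: frag_extend_fun_add frag_extend_fun_sum sum_subtractf numeral_2_eq_2)
  also have "\<dots> \<in> degen_chains (n - 1)"
  proof (intro degen_add degen_sum)
    fix i assume "i \<in> {..<length pre}"
    then have i: "i < length pre" by simp
    \<comment> \<open>Splitting \<open>pre\<close> at position \<open>i\<close> transfers validity
      and degree to the three pieces.\<close>
    note id = id_take_nth_drop[OF i]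
    have "valid_factors (take i pre @ pre ! i # drop (Suc i) pre)"
      and "weight pre = weight (take i pre @ pre ! i # drop (Suc i) pre)"
      using v(1) id by simp_all
    then show "?pre [as, bs] i - frag_extend (\<lambda>d. ?pre [d] i) ?S \<in> degen_chains (n - 1)"
      using degen_cmul[OF factor_boundary_before[OF y _ _ _ _ v(2) ab, of "pre ! i" "take i pre"
          "drop (Suc i) pre" n], of "(-1) ^ weight (take i pre)"] n
      by (simp add: T_def frag_linear)
  next
    have "T pre as ([bs] @ post) + T (pre @ [as]) bs post - frag_extend (\<lambda>d. T pre d post) ?S
      = frag_cmul ((-1) ^ weight pre) (factor_boundary y pre as ([bs] @ post)
    + frag_cmul ((-1) ^ length as) (factor_boundary y (pre @ [as]) bs post)
    - frag_extend (\<lambda>d. factor_boundary y pre d post) (shuf as bs))"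
      by (simp add: T_def frag_linear power_add)
    then show "T pre as ([bs] @ post) + T (pre @ [as]) bs post - frag_extend (\<lambda>d. T pre d post) ?S
      \<in> degen_chains (n - 1)"
      using degen_cmul[OF factor_boundary_shuffle[OF assms]] by simp
  next
    fix i assume "i \<in> {..<length post}"
    then have i: "i < length post" by simp
    note id = id_take_nth_drop[OF i]
    let ?e = "(-1) ^ (weight pre + length as + length bs + weight (take i post)) :: int"
    have *: "valid_factors (take i post @ post ! i # drop (Suc i) post)"
      and "weight post = weight (take i post @ post ! i # drop (Suc i) post)"
      using v(2) id by simp_all
    then have "frag_cmul ?e (factor_boundary y (pre @ [as, bs] @ take i post) (post ! i) (drop (Suc i) post)
      - frag_extend (\<lambda>d. factor_boundary y (pre @ [d] @ take i post) (post ! i) (drop (Suc i) post)) ?S)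
      \<in> degen_chains (n - 1)"
      using n by (intro degen_cmul factor_boundary_after[OF y _ _ v(1) _ _ ab]) simp_all
    \<comment> \<open>Shuffled tuples have length \<open>length as + length bs\<close>, so replacing
      the pair by one of them does not change the sign of a later factor.\<close>
    moreover have "frag_extend (\<lambda>d. ?post [d] i) ?S = frag_cmul ?e (frag_extend
        (\<lambda>d. factor_boundary y (pre @ [d] @ take i post) (post ! i) (drop (Suc i) post)) ?S)"
      unfolding frag_extend_fun_cmul[symmetric]
      using S(2) by (intro frag_extend_eq) (simp add: T_def add.assoc)
    ultimately show "?post [as, bs] i - frag_extend (\<lambda>d. ?post [d] i) ?S \<in> degen_chains (n - 1)"
      by (simp add: T_def frag_cmul_diff_distrib2 add.assoc)
  qed
  finally show ?thesis .
qed

lemma boundary_degen_chains: "boundary ` degen_chains n \<subseteq> degen_chains (n - 1)"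
proof (rule image_subsetI)
  fix x assume "x \<in> degen_chains n"
  then show "boundary x \<in> degen_chains (n - 1)"
    unfolding degen_chains_def[of n]
  proof (induction rule: generate.induct)
    case one
    then show ?case by (simp add: prism_chains_def boundary_def degen_zero)
  next
    case (incl h)
    then show ?case by (auto simp: degen_gens_eq intro: boundary_degen_elt)
  next
    case (inv h)
    then have "boundary h \<in> degen_chains (n - 1)"
      by (auto simp: degen_gens_eq intro: boundary_degen_elt)
    \<comment> \<open>The inverse is identified with negation on the carrier, so
      \<open>degen_gens_carrier\<close> enters here.\<close>
    moreover have "inv\<^bsub>prism_chains n\<^esub> h = - h"
      using subsetD[OF degen_gens_carrier inv] by (simp add: prism_chains_def)
    ultimately show ?case by (simp add: boundary_def frag_extend_minus degen_minus)
  next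
    case (eng h1 h2)
    then show ?case by (simp add: prism_chains_def boundary_def frag_extend_add degen_add)
  qed
qed

end

theorem lemma16:
  fixes \<Lambda> :: "'l set"
    and G :: "'l \<Rightarrow> ('a, 'm) monoid_scheme"
    and star :: "'a \<Rightarrow> 'a \<Rightarrow> 'a"
    and Y :: "'y set"
    and act :: "'y \<Rightarrow> 'a \<Rightarrow> 'y"
  assumes "multiple_conjugation_quandle \<Lambda> G star"
    and "mcq_set \<Lambda> G star Y act"
  shows "\<forall>n::int.
           subgroup (mcq_set.degen_chains \<Lambda> G star Y n) (mcq_set.prism_chains \<Lambda> G Y n)
           \<and> mcq_set.boundary \<Lambda> G star act ` mcq_set.degen_chains \<Lambda> G star Y n
               \<subseteq> mcq_set.degen_chains \<Lambda> G star Y (n - 1)"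
proof -
  interpret mcq_set \<Lambda> G star Y act by fact
  show ?thesis using subgroup_degen_chains boundary_degen_chains by blast
qed

end
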